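(* Let $\varepsilon>0$ and consider points in Euclidean space $\mathbb{R}^d$ (any dimension $d$) with Euclidean distance, where distinct points have distance in $[1,\Delta]$. There is a deterministic expiration-streaming algorithm that stores $\mathcal{O}((1/\varepsilon)\log\Delta)$ words and maintains a $(1+\sqrt{3}+\varepsilon)$-approximation of the diameter of the set of active items: at any query time $t$ it can report a value $r$ with $r\le\mathrm{diam}(X_t)\le(1+\sqrt3+\varepsilon)r$, where $X_t$ is the set of items active at time $t$.
   Context: Expiration streaming model: the input is a sequence of items $x_1,\dots,x_n$; each item $x$ consists of a data point $p(x)\in\mathbb{R}^d$, an integer insertion time $S(x)>0$ and an expiration time $E(x)>S(x)$ (possibly $\infty$), with $S(x_1)\le\dots\le S(x_n)$. An item $x$ is active at time $t$ if $S(x)\le t<E(x)$; queries at an arbitrary time $t$ (unknown in advance) are evaluated on the active items. Space is measured in machine words, where a word can store one point of $\mathbb{R}^d$, one time value, or a counter in the range $[\mathrm{poly}(n)]$. $\mathrm{diam}(X)=\max\{\|x-y\|_2:x,y\in X\}$. *)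

theory Defs
  imports "HOL-Analysis.Analysis" "HOL-Computational_Algebra.Polynomial"
begin

text \<open>
  The dimension is a natural number and not an index type, so that the constant hidden in
  the space bound can be quantified before (hence independently of) the dimension.  A point
  of \<open>\<real>\<^sup>d\<close> is a function \<open>nat \<Rightarrow> real\<close> that vanishes from index \<open>d\<close> on.  The library instance
  \<open>dist\<close> on this function type is not the Euclidean distance and is not used.
\<close>

type_synonym point = "nat \<Rightarrow> real"

definition points :: "nat \<Rightarrow> point set" where
  "points d = {p. \<forall>i\<ge>d. p i = 0}"

definition edist :: "nat \<Rightarrow> point \<Rightarrow> point \<Rightarrow> real" where
  "edist d p q = L2_set (\<lambda>i. p i - q i) {..<d}"

text \<open>The maximum is only used for finite sets; the empty set has diameter 0.\<close>

definition diam :: "nat \<Rightarrow> point set \<Rightarrow> real" where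
  "diam d X = (if X = {} then 0 else Max {edist d x y | x y. x \<in> X \<and> y \<in> X})"

datatype item = Item (pnt: point) (ins_time: int) (exp_time: ereal)

definition valid_item :: "nat \<Rightarrow> item \<Rightarrow> bool" where
  "valid_item d x \<longleftrightarrow>
     pnt x \<in> points d \<and> ins_time x > 0 \<and> exp_time x > ereal (of_int (ins_time x))"

definition valid_stream :: "nat \<Rightarrow> real \<Rightarrow> item list \<Rightarrow> bool" where
  "valid_stream d \<Delta> xs \<longleftrightarrow>
     (\<forall>x\<in>set xs. valid_item d x) \<and>
     sorted (map ins_time xs) \<and>
     (\<forall>x\<in>set xs. \<forall>y\<in>set xs. pnt x \<noteq> pnt y \<longrightarrow> edist d (pnt x) (pnt y) \<in> {1..\<Delta>})"

definition active :: "item list \<Rightarrow> real \<Rightarrow> item set" where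
  "active xs t = {x \<in> set xs. of_int (ins_time x) \<le> t \<and> ereal t < exp_time x}"

text \<open>
  The content of the memory is a list of machine words.  A deterministic streaming algorithm
  consists of an initial memory, a transition for each arriving item, and a query procedure
  which sees nothing but the memory and the query time.
\<close>

datatype mword = Point point | Time ereal | Counter nat

record streaming_algorithm =
  init :: "mword list"
  process :: "mword list \<Rightarrow> item \<Rightarrow> mword list"
  query :: "mword list \<Rightarrow> real \<Rightarrow> real"

definition memory :: "streaming_algorithm \<Rightarrow> item list \<Rightarrow> mword list" where
  "memory A xs = foldl (process A) (init A) xs"

text \<open>
  Since \<open>xs\<close> is sorted by insertion time, the items that have arrived by time \<open>t\<close> form a prefix.
\<close>

definition answer :: "streaming_algorithm \<Rightarrow> item list \<Rightarrow> real \<Rightarrow> real" where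
  "answer A xs t = query A (memory A (takeWhile (\<lambda>x. of_int (ins_time x) \<le> t) xs)) t"

text \<open>
  Transitions are arbitrary functions on exact reals, so a single unrestricted real number
  could encode the whole stream.  A point word therefore has to hold the data point, and a
  time word an insertion or expiration time, of an item that has already been read (\<open>ys\<close>);
  a counter is bounded by a polynomial \<open>b\<close> in the length \<open>n\<close> of the stream.
\<close>

fun word_ok :: "nat poly \<Rightarrow> nat \<Rightarrow> item list \<Rightarrow> mword \<Rightarrow> bool" where
  "word_ok b n ys (Point p) \<longleftrightarrow> p \<in> pnt ` set ys"
| "word_ok b n ys (Time \<tau>) \<longleftrightarrow>
     \<tau> \<in> exp_time ` set ys \<union> (\<lambda>y. ereal (of_int (ins_time y))) ` set ys"
| "word_ok b n ys (Counter c) \<longleftrightarrow> c \<le> poly b n"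

definition stores_words :: "nat poly \<Rightarrow> streaming_algorithm \<Rightarrow> item list \<Rightarrow> real \<Rightarrow> bool" where
  "stores_words b A xs s \<longleftrightarrow>
     (\<forall>m \<le> length xs.
        real (length (memory A (take m xs))) \<le> s \<and>
        (\<forall>w \<in> set (memory A (take m xs)). word_ok b (length xs) (take m xs) w))"

text \<open>
  The bound \<open>O((1/\<epsilon>) log \<Delta>)\<close> is meant for small \<open>\<epsilon>\<close> and large \<open>\<Delta>\<close>: as \<open>\<epsilon>\<close> grows or \<open>\<Delta>\<close>
  tends to 1 the expression tends to 0, although at least one word is always needed.  Bounding
  each factor from below by 1 makes it meaningful for all \<open>\<epsilon> > 0\<close> and \<open>\<Delta> \<ge> 1\<close>, and changes
  nothing if \<open>\<epsilon> \<le> 1\<close> and \<open>ln \<Delta> \<ge> 1\<close>.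
\<close>

definition space_bound :: "real \<Rightarrow> real \<Rightarrow> real" where
  "space_bound \<epsilon> \<Delta> = max 1 (1 / \<epsilon>) * max 1 (ln \<Delta>)"

end

theory Submission imports Defs begin

text \<open>
  For every guess \<open>\<gamma>\<close> on a geometric grid the memory keeps a witness, that is, a pair at distance
  at least \<open>\<gamma>\<close> whose earlier expiration \<open>\<tau>\<close> is as late as possible, and arranges that the items
  expiring after \<open>\<tau>\<close> have diameter at most \<open>(1 + \<surd>3) \<gamma>\<close>.  To this end it stores the
  latest-expiring item \<open>r\<close> and an anchor \<open>q\<^sub>0\<close> within \<open>\<surd>3 \<gamma>\<close> of all these items.  A new item is
  compared with the stored ones: either \<open>\<tau>\<close> increases, or it is within \<open>\<gamma>\<close> of \<open>q\<^sub>0\<close> and hence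
  within \<open>(1 + \<surd>3) \<gamma>\<close> of everything.  When \<open>\<tau>\<close> reaches the expiration of \<open>q\<^sub>0\<close>, the new anchor
  is \<open>r\<close>, so \<open>r\<close> must be within \<open>\<surd>3 \<gamma>\<close> of all items that outlive \<open>q\<^sub>0\<close>.  This is achieved by up
  to 14 further items at pairwise distance more than \<open>(\<surd>3 - 1) \<gamma>\<close>: an item within \<open>(\<surd>3 - 1) \<gamma>\<close>
  of one of them is close to \<open>r\<close> by the triangle inequality, and once there are 15 centres,
  the intersection of the balls of radius \<open>\<gamma>\<close> around them has diameter at most \<open>\<surd>3 \<gamma>\<close>.
\<close>

section \<open>Balls around separated points\<close>

lemma edist_nonneg: "0 \<le> edist d p q"
  by (simp add: edist_def L2_set_nonneg)

lemma edist_self [simp]: "edist d p p = 0"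
  by (simp add: edist_def L2_set_def)

lemma edist_commute: "edist d p q = edist d q p"
  by (simp add: edist_def L2_set_def power2_commute)

lemma edist_triangle: "edist d p r \<le> edist d p q + edist d q r"
  using L2_set_triangle_ineq[of "\<lambda>i. p i - q i" "\<lambda>i. q i - r i" "{..<d}"]
  by (simp add: edist_def)

lemma edist_power2: "(edist d p q)\<^sup>2 = (\<Sum>i<d. (p i - q i)\<^sup>2)"
  by (simp add: edist_def L2_set_def sum_nonneg)

text \<open>Used coordinate by coordinate. Shifting by the midpoint \<open>m\<close> of
  \<open>u\<close> and \<open>v\<close> keeps the differences; expanding leaves a negative square,
  which is dropped, and the parallelogram law expresses each \<open>g a\<close> squared through the
  squared distances to \<open>u\<close> and \<open>v\<close>.\<close>

lemma sum_sum_diff_power2_le: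
  fixes f :: "'a \<Rightarrow> real"
  shows "(\<Sum>a\<in>S. \<Sum>b\<in>S. (f a - f b)\<^sup>2)
    \<le> real (card S) * (\<Sum>a\<in>S. (u - f a)\<^sup>2 + (v - f a)\<^sup>2) - (real (card S))\<^sup>2 * (u - v)\<^sup>2 / 2"
proof -
  define m where "m = (u + v) / 2"
  define g where "g a = f a - m" for a
  let ?n = "real (card S)"
  have "(\<Sum>a\<in>S. \<Sum>b\<in>S. (f a - f b)\<^sup>2) = (\<Sum>a\<in>S. \<Sum>b\<in>S. (g a)\<^sup>2 + (g b)\<^sup>2 - 2 * (g a * g b))"
    by (intro sum.cong refl) (simp add: g_def power2_eq_square algebra_simps)
  also have "\<dots> = 2 * ?n * (\<Sum>a\<in>S. (g a)\<^sup>2) - 2 * (\<Sum>a\<in>S. g a)\<^sup>2"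
    by (simp add: sum.distrib sum_subtractf power2_eq_square sum_product flip: sum_distrib_left)
  also have "\<dots> \<le> 2 * ?n * (\<Sum>a\<in>S. (g a)\<^sup>2)"
    by simp
  also have "(\<Sum>a\<in>S. (g a)\<^sup>2) = (\<Sum>a\<in>S. ((u - f a)\<^sup>2 + (v - f a)\<^sup>2) / 2 - (u - v)\<^sup>2 / 4)"
    by (intro sum.cong refl) (simp add: g_def m_def power2_eq_square field_simps)
  also have "\<dots> = (\<Sum>a\<in>S. (u - f a)\<^sup>2 + (v - f a)\<^sup>2) / 2 - ?n * ((u - v)\<^sup>2 / 4)"
    by (simp add: sum_subtractf sum_divide_distrib)
  also have "2 * ?n * \<dots> = ?n * (\<Sum>a\<in>S. (u - f a)\<^sup>2 + (v - f a)\<^sup>2) - ?n\<^sup>2 * (u - v)\<^sup>2 / 2"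
    by (simp only: power2_eq_square[of ?n]) (simp add: right_diff_distrib)
  finally show ?thesis .
qed

lemma sqrt3_less: "sqrt 3 < 97 / 56"
  by (rule real_less_lsqrt) (simp_all add: power2_eq_square)

lemma less_sqrt3: "17 / 10 < sqrt 3"
  by (rule real_less_rsqrt) (simp add: power2_eq_square)

text \<open>
  Averaging \<open>|y - a|\<^sup>2 + |z - a|\<^sup>2\<close> over \<open>k\<close> centres \<open>a\<close> gives
  \<open>|y - z|\<^sup>2 \<le> (4 - 2 (\<surd>3 - 1)\<^sup>2 (k - 1) / k) \<gamma>\<^sup>2\<close>, and \<open>k = 15\<close> is the least number for which this is
  at most \<open>3 \<gamma>\<^sup>2\<close>; the condition then reads \<open>\<surd>3 \<le> 97/56\<close>.
\<close>

lemma edist_le_if_in_separated_balls: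
  assumes card: "card S = 15" and \<gamma>: "0 \<le> \<gamma>"
    and sep: "pairwise (\<lambda>a b. (sqrt 3 - 1) * \<gamma> < edist d (f a) (f b)) S"
    and y: "\<And>a. a \<in> S \<Longrightarrow> edist d y (f a) \<le> \<gamma>"
    and z: "\<And>a. a \<in> S \<Longrightarrow> edist d z (f a) \<le> \<gamma>"
  shows "edist d y z \<le> sqrt 3 * \<gamma>"
proof -
  have fin: "finite S" using card card.infinite by fastforce
  let ?l = "((sqrt 3 - 1) * \<gamma>)\<^sup>2"
  \<comment> \<open>\<open>210 = 15 * 14\<close> counts the ordered pairs of distinct
    centres.\<close>
  have "210 * ?l = (\<Sum>a\<in>S. \<Sum>b\<in>S - {a}. ?l)"
    using card fin by simp
  also have "\<dots> \<le> (\<Sum>a\<in>S. \<Sum>b\<in>S - {a}. (edist d (f a) (f b))\<^sup>2)"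
  proof (intro sum_mono power_mono)
    fix a b assume "a \<in> S" "b \<in> S - {a}"
    then show "(sqrt 3 - 1) * \<gamma> \<le> edist d (f a) (f b)"
      using sep unfolding pairwise_def by force
  qed (use \<gamma> less_sqrt3 in auto)
  also have "\<dots> = (\<Sum>a\<in>S. \<Sum>b\<in>S. (edist d (f a) (f b))\<^sup>2)"
    using fin by (intro sum.cong refl sum.mono_neutral_left) auto
  also have "\<dots> = (\<Sum>i<d. \<Sum>a\<in>S. \<Sum>b\<in>S. (f a i - f b i)\<^sup>2)"
    unfolding edist_power2 by (subst sum.swap) (subst (2) sum.swap, rule refl)
  also have "\<dots> \<le> (\<Sum>i<d. 15 * (\<Sum>a\<in>S. (y i - f a i)\<^sup>2 + (z i - f a i)\<^sup>2) - 225 * (y i - z i)\<^sup>2 / 2)"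
    using sum_sum_diff_power2_le[of _ S] card by (intro sum_mono) force
  also have "\<dots> = 15 * (\<Sum>a\<in>S. (edist d y (f a))\<^sup>2 + (edist d z (f a))\<^sup>2) - 225 * (edist d y z)\<^sup>2 / 2"
    unfolding edist_power2 sum.distrib[symmetric] sum_subtractf
      sum_distrib_left[symmetric] sum_divide_distrib[symmetric]
    by (subst sum.swap) (rule refl)
  also have "(\<Sum>a\<in>S. (edist d y (f a))\<^sup>2 + (edist d z (f a))\<^sup>2) \<le> (\<Sum>a\<in>S. \<gamma>\<^sup>2 + \<gamma>\<^sup>2)"
    using y z by (intro sum_mono add_mono power_mono) (auto simp: edist_nonneg)
  also have "(\<Sum>a\<in>S. \<gamma>\<^sup>2 + \<gamma>\<^sup>2) = 30 * \<gamma>\<^sup>2"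
    using card by simp
  finally have "225 * (edist d y z)\<^sup>2 / 2 \<le> 450 * \<gamma>\<^sup>2 - 210 * ?l"
    by simp
  also have "?l = (4 - 2 * sqrt 3) * \<gamma>\<^sup>2"
    by (simp add: power_mult_distrib power2_diff)
  finally have "225 * (edist d y z)\<^sup>2 / 2 \<le> (420 * sqrt 3 - 390) * \<gamma>\<^sup>2"
    by (simp add: algebra_simps)
  also have "\<dots> \<le> 675 / 2 * \<gamma>\<^sup>2"
    using sqrt3_less by (intro mult_right_mono) auto
  finally have "(edist d y z)\<^sup>2 \<le> (sqrt 3 * \<gamma>)\<^sup>2"
    by (simp add: power_mult_distrib)
  then show ?thesis
    by (rule power2_le_imp_le) (use \<gamma> in auto)
qed

section \<open>The invariant for a single guess\<close>

type_synonym key = "point \<times> ereal"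

abbreviation kdist :: "nat \<Rightarrow> key \<Rightarrow> key \<Rightarrow> real" where
  "kdist d x y \<equiv> edist d (fst x) (fst y)"

text \<open>
  \<open>P\<close> are the items read so far, \<open>\<tau>\<close> the time until which the witness lasts, \<open>hd Q\<close> the anchor, and
  \<open>R\<close> holds the latest-expiring item (or nothing, before the first arrival).
\<close>

locale anchored =
  fixes d :: nat and \<gamma> :: real and P :: "key set" and \<tau> :: ereal and Q R :: "key list"
  assumes pos: "0 \<le> \<gamma>"
    and Q_subset: "set Q \<subseteq> P"
    and R_subset: "set R \<subseteq> P"
    and R_length: "length R \<le> 1"
    and R_latest: "y \<in> P \<Longrightarrow> \<exists>r\<in>set R. snd y \<le> snd r"
    and Q_distinct: "distinct Q"
    and Q_length: "length Q \<le> 15"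
    and Q_separated: "pairwise (\<lambda>a b. (sqrt 3 - 1) * \<gamma> < kdist d a b) (set Q)"
    and hd_alive: "q \<in> set Q \<Longrightarrow> \<tau> < snd (hd Q)"
    and hd_least: "q \<in> set Q \<Longrightarrow> snd (hd Q) \<le> snd q"
    and Q_nonempty: "y \<in> P \<Longrightarrow> \<tau> < snd y \<Longrightarrow> Q \<noteq> []"
    and near_hd: "y \<in> P \<Longrightarrow> \<tau> < snd y \<Longrightarrow> kdist d y (hd Q) \<le> sqrt 3 * \<gamma>"
    and covered: "Q \<noteq> [] \<Longrightarrow> y \<in> P \<Longrightarrow> snd (hd Q) < snd y \<Longrightarrow>
        (\<exists>q\<in>set Q. kdist d y q \<le> (sqrt 3 - 1) * \<gamma>) \<or>
        length Q = 15 \<and> (\<forall>q\<in>set Q. kdist d y q \<le> \<gamma>)"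
    and R_near_Q: "r \<in> set R \<Longrightarrow> q \<in> set Q \<Longrightarrow> kdist d r q \<le> \<gamma>"
    and spread: "y \<in> P \<Longrightarrow> z \<in> P \<Longrightarrow> \<tau> < snd y \<Longrightarrow> \<tau> < snd z \<Longrightarrow>
        kdist d y z \<le> (1 + sqrt 3) * \<gamma>"

section \<open>Updates of the stored items and preservation of the invariant\<close>

text \<open>The centres only prepare the handover from the anchor to the latest item, so they are
  discarded together with the anchor.\<close>

definition refresh :: "ereal \<Rightarrow> key list \<Rightarrow> key list \<Rightarrow> key list" where
  "refresh \<tau> Q R = (if Q \<noteq> [] \<and> \<tau> < snd (hd Q) then Q else filter (\<lambda>r. \<tau> < snd r) R)"

text \<open>The head of \<open>Q\<close> is the anchor, the rest are centres. Only items outliving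
  the anchor matter after the handover, so only they become centres.\<close>

definition enroll :: "nat \<Rightarrow> real \<Rightarrow> ereal \<Rightarrow> key list \<Rightarrow> key \<Rightarrow> key list" where
  "enroll d \<gamma> \<tau> Q x =
     (if \<tau> < snd x \<and> (Q = [] \<or> snd (hd Q) < snd x \<and> length Q < 15 \<and>
          (\<forall>q\<in>set Q. (sqrt 3 - 1) * \<gamma> < kdist d x q))
      then Q @ [x] else Q)"

definition latest :: "key list \<Rightarrow> key \<Rightarrow> key list" where
  "latest R x = (if R = [] \<or> snd (hd R) < snd x then [x] else R)"

context anchored
begin

lemma R_cases:
  obtains "R = []" "P = {}" | r where "R = [r]" "r \<in> P" "\<And>y. y \<in> P \<Longrightarrow> snd y \<le> snd r"
proof (cases R)
  case Nil
  then have "P = {}" using R_latest by fastforce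
  then show ?thesis using Nil that by blast
next
  case (Cons r R')
  then have "R = [r]" using R_length by simp
  then show ?thesis using that(2)[of r] R_subset R_latest by auto
qed

text \<open>This qualifies \<open>r\<close> as the next anchor. In the first case of
  \<open>covered\<close> the distances via a centre add up to \<open>sqrt 3 * \<gamma>\<close>; in
  the second, \<open>y\<close> and \<open>r\<close> both lie in all 15 balls.\<close>

lemma near_R:
  assumes y: "y \<in> P" "snd (hd Q) < snd y" "Q \<noteq> []" and r: "r \<in> set R"
  shows "kdist d y r \<le> sqrt 3 * \<gamma>"
  using covered[OF y(3,1,2)]
proof
  assume "\<exists>q\<in>set Q. kdist d y q \<le> (sqrt 3 - 1) * \<gamma>"
  then obtain q where q: "q \<in> set Q" "kdist d y q \<le> (sqrt 3 - 1) * \<gamma>" by blast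
  have "kdist d y r \<le> kdist d y q + kdist d r q"
    using edist_triangle[of d "fst y" "fst r" "fst q"] by (simp add: edist_commute)
  also have "\<dots> \<le> (sqrt 3 - 1) * \<gamma> + \<gamma>"
    using q R_near_Q r by (intro add_mono) auto
  finally show ?thesis by (simp add: algebra_simps)
next
  assume *: "length Q = 15 \<and> (\<forall>q\<in>set Q. kdist d y q \<le> \<gamma>)"
  show ?thesis
    by (rule edist_le_if_in_separated_balls[of "set Q" \<gamma> d fst])
      (use * Q_distinct Q_separated R_near_Q r pos in \<open>auto simp: distinct_card\<close>)
qed

text \<open>A later horizon leaves fewer items to control, so only a handover is critical. There
  \<open>near_R\<close> supplies \<open>near_hd\<close>, and \<open>covered\<close> is vacuous
  because nothing outlives the latest item.\<close>

lemma refresh: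
  assumes le: "\<tau> \<le> \<tau>'"
  shows "anchored d \<gamma> P \<tau>' (refresh \<tau>' Q R) R"
proof (cases "Q \<noteq> [] \<and> \<tau>' < snd (hd Q)")
  case True
  then have "refresh \<tau>' Q R = Q" by (simp add: refresh_def)
  moreover have "\<tau> < snd y" if "\<tau>' < snd y" for y :: key
    using le that by (rule le_less_trans)
  ultimately show ?thesis
    using True covered near_hd spread R_near_Q R_latest R_length hd_least
    by unfold_locales (auto simp: pos Q_subset R_subset Q_distinct Q_length Q_separated)
next
  case False
  then have eq: "refresh \<tau>' Q R = filter (\<lambda>r. \<tau>' < snd r) R"
    by (simp only: refresh_def if_False)
  have old: "\<tau> < snd y" if "\<tau>' < snd y" for y :: key
    using le that by (rule le_less_trans)
  \<comment> \<open>The old anchor has expired by \<open>\<tau>'\<close>, so whatever outlives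
    \<open>\<tau>'\<close> outlives the anchor.\<close>
  have alive: "Q \<noteq> []" "snd (hd Q) < snd y" if "y \<in> P" "\<tau>' < snd y" for y
  proof -
    show "Q \<noteq> []" using Q_nonempty that(1) old[OF that(2)] by blast
    then have "snd (hd Q) \<le> \<tau>'" using False by (simp add: not_less)
    then show "snd (hd Q) < snd y" using that(2) by (rule le_less_trans)
  qed
  show ?thesis
  proof (cases rule: R_cases)
    case 1
    then show ?thesis unfolding eq by unfold_locales (simp_all add: pos)
  next
    case (2 r)
    have near: "kdist d y r \<le> sqrt 3 * \<gamma>" if "y \<in> P" "\<tau>' < snd y" for y
      using near_R[of y r] alive that 2 by simp
    show ?thesis
    proof (cases "\<tau>' < snd r")
      case True
      then show ?thesis unfolding eq
        using 2(3) leD[OF 2(3)] spread old near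
        by unfold_locales (simp_all add: pos 2)
    next
      case False
      moreover have "\<not> \<tau>' < snd y" if "y \<in> P" for y
        using 2(3)[OF that] False by (meson less_le_trans)
      ultimately show ?thesis unfolding eq using 2(3)
        by unfold_locales (simp_all add: pos 2)
    qed
  qed
qed

text \<open>The premise says that \<open>x\<close> forms no longer-lasting witness with a stored
  item. Hence \<open>x\<close>, if it outlives the horizon, is within \<open>\<gamma>\<close> of the
  anchor and of all centres.\<close>

lemma insert:
  assumes near: "\<And>q. q \<in> set Q \<union> set R \<Longrightarrow> \<tau> < snd x \<Longrightarrow> \<tau> < snd q \<Longrightarrow> kdist d x q < \<gamma>"
  shows "anchored d \<gamma> (insert x P) \<tau> (enroll d \<gamma> \<tau> Q x) (latest R x)"
proof -
  have s: "\<gamma> \<le> sqrt 3 * \<gamma>" "0 \<le> (sqrt 3 - 1) * \<gamma>"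
    using pos less_sqrt3 by (auto simp: mult_le_cancel_right1)
  let ?Q = "enroll d \<gamma> \<tau> Q x" and ?R = "latest R x"
  have Q_alive: "\<tau> < snd q" if "q \<in> set Q" for q
    using hd_alive[OF that] hd_least[OF that] by (rule less_le_trans)
  have hd: "hd ?Q = hd Q" if "Q \<noteq> []"
    using that by (simp add: enroll_def)
  have x_near: "kdist d x q < \<gamma>" if "q \<in> set Q" "\<tau> < snd x" for q
    using near that Q_alive by blast
  have x_alive: "\<tau> < snd x" if "Q \<noteq> []" "snd (hd Q) < snd x"
    using Q_alive[of "hd Q"] that less_trans by auto
  have Q_new: "?Q = [x]" "\<tau> < snd x" if "Q = []" "?Q \<noteq> []"
    using that by (auto simp: enroll_def split: if_splits)
  have Q_cases: "?Q = Q \<or> ?Q = Q @ [x] \<and> \<tau> < snd x"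
    by (simp add: enroll_def)
  have R_x: "snd (hd Q) < snd x" if "x \<in> set ?R" "x \<notin> set R" "Q \<noteq> []"
  proof -
    have "hd Q \<in> P" using that Q_subset by auto
    then show ?thesis
    proof (cases rule: R_cases)
      case (2 r)
      \<comment> \<open>\<open>latest\<close> replaces \<open>r\<close> only by an item that expires
        strictly later, and \<open>r\<close> expires no earlier than the anchor.\<close>
      then have "snd r < snd x" using that by (auto simp: latest_def split: if_splits)
      then show ?thesis using 2 \<open>hd Q \<in> P\<close> le_less_trans by blast
    qed simp
  qed
  \<comment> \<open>Going through the anchor costs \<open>\<gamma>\<close> for the new item and
    \<open>sqrt 3 * \<gamma>\<close> for the old one; this is the source of the factor
    \<open>1 + sqrt 3\<close>.\<close>
  have diam_x: "kdist d x y \<le> (1 + sqrt 3) * \<gamma>" if "y \<in> P" "\<tau> < snd x" "\<tau> < snd y" for y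
  proof -
    have "kdist d x (hd Q) < \<gamma>" using x_near Q_nonempty that by simp
    moreover have "kdist d y (hd Q) \<le> sqrt 3 * \<gamma>" using near_hd that by blast
    moreover have "kdist d x y \<le> kdist d x (hd Q) + kdist d y (hd Q)"
      using edist_triangle[of d "fst x" "fst y" "fst (hd Q)"] by (simp add: edist_commute)
    ultimately show ?thesis by (simp add: algebra_simps)
  qed
  have enlarged: "distinct ?Q \<and> length ?Q \<le> 15 \<and>
     pairwise (\<lambda>a b. (sqrt 3 - 1) * \<gamma> < kdist d a b) (set ?Q)"
  proof (cases "?Q = Q")
    case True
    then show ?thesis using Q_distinct Q_length Q_separated by simp
  next
    case False
    then have Q: "?Q = Q @ [x]" "length Q < 15" "\<forall>q\<in>set Q. (sqrt 3 - 1) * \<gamma> < kdist d x q"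
      by (auto simp: enroll_def split: if_splits)
    then have "x \<notin> set Q" using s(2) by fastforce
    then show ?thesis using Q Q_distinct Q_separated by (simp add: pairwise_insert edist_commute)
  qed
  show ?thesis
  proof
    show "0 \<le> \<gamma>" by (rule pos)
    show "set ?Q \<subseteq> insert x P" using Q_subset by (auto simp: enroll_def)
    show "set ?R \<subseteq> insert x P" using R_subset by (auto simp: latest_def)
    show "length ?R \<le> 1" using R_length by (simp add: latest_def)
    show "distinct ?Q" "length ?Q \<le> 15"
      "pairwise (\<lambda>a b. (sqrt 3 - 1) * \<gamma> < kdist d a b) (set ?Q)"
      using enlarged by blast+
  next
    fix y assume y: "y \<in> insert x P"
    show "\<exists>r\<in>set ?R. snd y \<le> snd r"
    proof (cases rule: R_cases)
      case 1
      then show ?thesis using y by (simp add: latest_def)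
    next
      case (2 r)
      show ?thesis
      proof (cases "snd r < snd x")
        case True
        then have "snd y \<le> snd x" if "y \<in> P" using 2(3)[OF that] by simp
        then show ?thesis using y True 2(1) by (auto simp: latest_def)
      next
        case False
        then show ?thesis using y 2(1) 2(3)[of y] by (auto simp: latest_def not_less)
      qed
    qed
  next
    fix q assume q: "q \<in> set ?Q"
    then have ne: "?Q \<noteq> []" by auto
    show "\<tau> < snd (hd ?Q)"
    proof (cases "Q = []")
      case True
      show ?thesis using Q_new[OF True ne] by simp
    next
      case False
      then show ?thesis using hd[OF False] Q_alive[of "hd Q"] by simp
    qed
    show "snd (hd ?Q) \<le> snd q"
    proof (cases "Q = []")
      case True
      show ?thesis using q Q_new[OF True ne] by simp
    next
      case False
      have "q \<in> set Q \<or> q = x \<and> snd (hd Q) < snd x"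
        using q False by (auto simp: enroll_def split: if_splits)
      then show ?thesis unfolding hd[OF False] using hd_least less_imp_le by blast
    qed
  next
    fix y assume y: "y \<in> insert x P" "\<tau> < snd y"
    show "?Q \<noteq> []"
    proof (cases "Q = []")
      case True
      then have "y = x" using Q_nonempty y by blast
      then show ?thesis using True y by (simp add: enroll_def)
    qed (simp add: enroll_def)
    show "kdist d y (hd ?Q) \<le> sqrt 3 * \<gamma>"
    proof (cases "Q = []")
      case True
      then have "y = x" using Q_nonempty y by blast
      then show ?thesis using True y pos by (simp add: enroll_def)
    next
      case False
      then have "kdist d x (hd Q) \<le> sqrt 3 * \<gamma>" if "y = x"
        using x_near[of "hd Q"] y s(1) that by simp
      then show ?thesis using y near_hd[of y] hd[OF False] by auto
    qed
  next
    fix y assume ne: "?Q \<noteq> []" and y: "y \<in> insert x P" "snd (hd ?Q) < snd y"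
    show "(\<exists>q\<in>set ?Q. kdist d y q \<le> (sqrt 3 - 1) * \<gamma>) \<or>
        length ?Q = 15 \<and> (\<forall>q\<in>set ?Q. kdist d y q \<le> \<gamma>)"
    proof (cases "Q = []")
      case True
      \<comment> \<open>Now \<open>x\<close> is the anchor, so \<open>y\<close> is an old item
        outliving the horizon, which an empty \<open>Q\<close> rules out.\<close>
      note Q = Q_new[OF True ne]
      then have "\<tau> < snd y" using y by (auto intro: less_trans)
      moreover have "y \<in> P" using Q y by auto
      ultimately show ?thesis using Q_nonempty True by blast
    next
      case False
      then have gt: "snd (hd Q) < snd y" using y hd by simp
      show ?thesis
      proof (cases "y = x")
        case True
        then have "\<tau> < snd x" using gt x_alive False by blast
        moreover from this have "\<forall>q\<in>set Q. kdist d x q \<le> \<gamma>"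
          using x_near by (simp add: less_imp_le)
        \<comment> \<open>With a place free, \<open>x\<close> is close to a stored item or is
          enrolled and covers itself; with none free, the second alternative holds.\<close>
        ultimately show ?thesis
          using True gt s(2) Q_length by (cases "length Q < 15") (auto simp: enroll_def not_less)
      next
        case neq: False
        \<comment> \<open>A full \<open>Q\<close> is not extended, so the second alternative
          persists as well.\<close>
        then show ?thesis
          using covered[OF False _ gt] y by (auto simp: enroll_def)
      qed
    qed
  next
    fix r q assume r: "r \<in> set ?R" and q: "q \<in> set ?Q"
    consider "r = x" "q = x" | "r \<in> set R" "q \<in> set Q"
      | "r = x" "r \<notin> set R" "q \<in> set Q" | "q = x" "r \<in> set R" "r \<noteq> x" "q \<notin> set Q"
      using r q by (auto simp: enroll_def latest_def split: if_splits)
    then show "kdist d r q \<le> \<gamma>"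
    proof cases
      case 3
      then have "Q \<noteq> []" by auto
      then have "\<tau> < snd x" using x_alive R_x r 3 by blast
      then show ?thesis using x_near 3 by (simp add: less_imp_le)
    next
      case 4
      \<comment> \<open>Since \<open>x\<close> did not displace \<open>r\<close>, the latter expires
        no earlier than \<open>x\<close>; so \<open>r\<close> is alive and the premise applies to
        it.\<close>
      then have "\<tau> < snd x" using q Q_cases by auto
      moreover have "snd x \<le> snd r"
        using 4 r R_length by (cases R) (auto simp: latest_def split: if_splits)
      ultimately show ?thesis
        using near[of r] 4 less_le_trans by (force simp: edist_commute)
    qed (use pos R_near_Q in auto)
  next
    fix y z assume "y \<in> insert x P" "z \<in> insert x P" "\<tau> < snd y" "\<tau> < snd z"
    then show "kdist d y z \<le> (1 + sqrt 3) * \<gamma>"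
      using spread[of y z] diam_x[of y] diam_x[of z] pos by (auto simp: edist_commute)
  qed
qed

end

section \<open>Processing a stream for a single guess\<close>

text \<open>With no pair found, no time is witnessed, whence the default
  \<open>-\<infinity>\<close>.\<close>

definition horizon :: "key list \<Rightarrow> ereal" where
  "horizon W = (if W = [] then -\<infinity> else Min (snd ` set W))"

definition witness :: "nat \<Rightarrow> real \<Rightarrow> key \<Rightarrow> key list \<Rightarrow> key list \<Rightarrow> key list" where
  "witness d \<gamma> x =
     fold (\<lambda>q W. if \<gamma> \<le> kdist d x q \<and> horizon W < min (snd x) (snd q) then [x, q] else W)"

lemma witness_cases:
  "witness d \<gamma> x C W = W \<or> (\<exists>q\<in>set C. witness d \<gamma> x C W = [x, q] \<and> \<gamma> \<le> kdist d x q)"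
  by (induction C arbitrary: W) (auto simp: witness_def split: if_splits)

lemma horizon_witness_mono: "horizon W \<le> horizon (witness d \<gamma> x C W)"
proof (induction C arbitrary: W)
  case (Cons q C)
  let ?W = "witness d \<gamma> x [q] W"
  have "horizon W \<le> horizon ?W"
    by (auto simp: witness_def horizon_def min_def)
  also have "\<dots> \<le> horizon (witness d \<gamma> x C ?W)" by (rule Cons.IH)
  finally show ?case by (simp add: witness_def)
qed (simp add: witness_def)

lemma min_le_horizon_witness:
  assumes "q \<in> set C" "\<gamma> \<le> kdist d x q"
  shows "min (snd x) (snd q) \<le> horizon (witness d \<gamma> x C W)"
  using assms
proof (induction C arbitrary: W)
  case (Cons c C)
  let ?W = "witness d \<gamma> x [c] W"
  have eq: "witness d \<gamma> x (c # C) W = witness d \<gamma> x C ?W"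
    by (simp add: witness_def)
  show ?case
  proof (cases "q = c")
    case True
    have "?W = (if horizon W < min (snd x) (snd q) then [x, q] else W)"
      using True Cons.prems by (simp add: witness_def)
    moreover have "horizon [x, q] = min (snd x) (snd q)"
      by (simp add: horizon_def)
    ultimately have "min (snd x) (snd q) \<le> horizon ?W"
      by (simp only: not_less split: if_split) simp
    also have "\<dots> \<le> horizon (witness d \<gamma> x C ?W)" by (rule horizon_witness_mono)
    finally show ?thesis by (simp only: eq)
  next
    case False
    then show ?thesis using Cons unfolding eq by simp
  qed
qed simp

type_synonym level = "key list \<times> key list \<times> key list"

definition level_step :: "nat \<Rightarrow> real \<Rightarrow> level \<Rightarrow> key \<Rightarrow> level" where
  "level_step d \<gamma> = (\<lambda>(W, Q, R) x.
     let W' = witness d \<gamma> x (Q @ R) W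
     in (W', enroll d \<gamma> (horizon W') (refresh (horizon W') Q R) x, latest R x))"

definition level_run :: "nat \<Rightarrow> real \<Rightarrow> key list \<Rightarrow> level" where
  "level_run d \<gamma> = foldl (level_step d \<gamma>) ([], [], [])"

definition level_inv :: "nat \<Rightarrow> real \<Rightarrow> key set \<Rightarrow> level \<Rightarrow> bool" where
  "level_inv d \<gamma> P = (\<lambda>(W, Q, R).
     (W = [] \<or> (\<exists>a\<in>P. \<exists>b\<in>P. W = [a, b] \<and> \<gamma> \<le> kdist d a b)) \<and>
     anchored d \<gamma> P (horizon W) Q R)"

text \<open>All of \<open>Q @ R\<close> is scanned for witnesses before anything is discarded. A
  stored item at distance at least \<open>\<gamma>\<close> from \<open>x\<close> would therefore
  have pushed the horizon to the earlier of the two expirations, which gives the premise of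
  \<open>insert\<close>.\<close>

lemma level_inv_step:
  assumes "level_inv d \<gamma> P s"
  shows "level_inv d \<gamma> (insert x P) (level_step d \<gamma> s x)"
proof -
  obtain W Q R where s: "s = (W, Q, R)" by (cases s) auto
  let ?W = "witness d \<gamma> x (Q @ R) W"
  let ?\<tau> = "horizon ?W"
  have W: "W = [] \<or> (\<exists>a\<in>P. \<exists>b\<in>P. W = [a, b] \<and> \<gamma> \<le> kdist d a b)"
    and anch: "anchored d \<gamma> P (horizon W) Q R"
    using assms by (auto simp: level_inv_def s)
  interpret anchored d \<gamma> P "horizon W" Q R by (rule anch)
  have W': "?W = [] \<or> (\<exists>a\<in>insert x P. \<exists>b\<in>insert x P. ?W = [a, b] \<and> \<gamma> \<le> kdist d a b)"
    using witness_cases[of d \<gamma> x "Q @ R" W] W Q_subset R_subset by fastforce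
  interpret r: anchored d \<gamma> P ?\<tau> "refresh ?\<tau> Q R" R
    by (rule refresh) (rule horizon_witness_mono)
  have "kdist d x q < \<gamma>"
    if "q \<in> set (refresh ?\<tau> Q R) \<union> set R" "?\<tau> < snd x" "?\<tau> < snd q" for q
  proof (rule ccontr)
    assume "\<not> kdist d x q < \<gamma>"
    moreover have "q \<in> set (Q @ R)" using that(1) by (auto simp: refresh_def split: if_splits)
    ultimately have "min (snd x) (snd q) \<le> ?\<tau>" by (intro min_le_horizon_witness) auto
    then show False using that by (auto simp: min_le_iff_disj)
  qed
  then have "anchored d \<gamma> (insert x P) ?\<tau> (enroll d \<gamma> ?\<tau> (refresh ?\<tau> Q R) x) (latest R x)"
    by (rule r.insert)
  then show ?thesis using W' by (simp add: level_inv_def level_step_def s Let_def)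
qed

lemma level_inv_run:
  assumes "0 \<le> \<gamma>"
  shows "level_inv d \<gamma> (set ks) (level_run d \<gamma> ks)"
proof (induction ks rule: rev_induct)
  case Nil
  show ?case using assms by (auto simp: level_run_def level_inv_def intro: anchored.intro)
next
  case (snoc k ks)
  then show ?case using level_inv_step[of d \<gamma> "set ks" _ k] by (simp add: level_run_def)
qed

lemma witnessed:
  assumes "0 \<le> \<gamma>" "t < horizon (fst (level_run d \<gamma> ks))"
  obtains a b where "a \<in> set ks" "b \<in> set ks" "t < snd a" "t < snd b" "\<gamma> \<le> kdist d a b"
  using level_inv_run[OF assms(1), of d ks] assms(2) that
  by (auto simp: level_inv_def horizon_def split: prod.splits if_splits)

text \<open>Items alive at a time not before the horizon outlive the horizon, so
  \<open>spread\<close> applies.\<close>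

lemma unwitnessed:
  assumes "0 \<le> \<gamma>" "\<not> t < horizon (fst (level_run d \<gamma> ks))"
    and "a \<in> set ks" "b \<in> set ks" "t < snd a" "t < snd b"
  shows "kdist d a b \<le> (1 + sqrt 3) * \<gamma>"
proof -
  obtain W Q R where run: "level_run d \<gamma> ks = (W, Q, R)" by (cases "level_run d \<gamma> ks") auto
  interpret anchored d \<gamma> "set ks" "horizon W" Q R
    using level_inv_run[OF assms(1), of d ks] by (simp add: level_inv_def run)
  have "horizon W \<le> t" using assms(2) by (simp add: run not_less)
  then show ?thesis using assms by (intro spread) (auto intro: le_less_trans)
qed

section \<open>The algorithm and its memory\<close>

text \<open>
  \<open>Counter 0\<close> serves as a terminator, so that the contents can be decoded and the counters are
  bounded by the zero polynomial.
\<close>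

definition encode_keys :: "key list \<Rightarrow> mword list" where
  "encode_keys ks = concat (map (\<lambda>(p, e). [Point p, Time e]) ks) @ [Counter 0]"

definition encode_level :: "level \<Rightarrow> mword list" where
  "encode_level = (\<lambda>(W, Q, R). encode_keys W @ encode_keys Q @ encode_keys R)"

definition encode :: "level list \<Rightarrow> mword list" where
  "encode ls = concat (map encode_level ls)"

lemma encode_keys_simps [simp]:
  "encode_keys [] = [Counter 0]"
  "encode_keys (k # ks) = Point (fst k) # Time (snd k) # encode_keys ks"
  by (simp_all add: encode_keys_def case_prod_unfold)

text \<open>The code is prefix-free: its next word tells whether another key follows or the list
  ends.\<close>

lemma encode_keys_append_eq: "encode_keys a @ u = encode_keys b @ v \<longleftrightarrow> a = b \<and> u = v"
proof (induction a arbitrary: b)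
  case Nil
  show ?case by (cases b) auto
next
  case IH: (Cons k a)
  show ?case
  proof (cases b)
    case Nil
    then show ?thesis by simp
  next
    case (Cons k' b')
    then show ?thesis using IH.IH[of b'] by (simp add: prod_eq_iff conj_assoc)
  qed
qed

lemma encode_level_append_eq: "encode_level a @ u = encode_level b @ v \<longleftrightarrow> a = b \<and> u = v"
  by (auto simp: encode_level_def encode_keys_append_eq split: prod.splits)

lemma encode_level_nonempty: "encode_level a \<noteq> []"
  by (simp add: encode_level_def encode_keys_def split: prod.splits)

lemma inj_encode: "inj encode"
proof (rule injI)
  fix a b :: "level list"
  assume "encode a = encode b"
  then show "a = b"
  proof (induction a arbitrary: b)
    case Nil
    then show ?case by (cases b) (auto simp: encode_def encode_level_nonempty)
  next
    case (Cons l a)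
    then show ?case
      by (cases b) (auto simp: encode_def encode_level_nonempty encode_level_append_eq)
  qed
qed

lemma set_encode_keys:
  assumes "set ks \<subseteq> P"
  shows "set (encode_keys ks) \<subseteq> {Counter 0} \<union> (\<Union>k\<in>P. {Point (fst k), Time (snd k)})"
  using assms by (induction ks) auto

lemma length_encode_keys: "length (encode_keys ks) = 2 * length ks + 1"
  by (induction ks) auto

lemma encode_level_run:
  assumes "0 \<le> \<gamma>"
  shows "length (encode_level (level_run d \<gamma> ks)) \<le> 39"
    and "set (encode_level (level_run d \<gamma> ks))
      \<subseteq> {Counter 0} \<union> (\<Union>k\<in>set ks. {Point (fst k), Time (snd k)})"
proof -
  obtain W Q R where run: "level_run d \<gamma> ks = (W, Q, R)" by (cases "level_run d \<gamma> ks") auto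
  have inv: "level_inv d \<gamma> (set ks) (W, Q, R)"
    using level_inv_run[OF assms, of d ks] by (simp add: run)
  interpret anchored d \<gamma> "set ks" "horizon W" Q R
    using inv by (simp add: level_inv_def)
  have W: "length W \<le> 2" "set W \<subseteq> set ks"
    using inv by (auto simp: level_inv_def)
  \<comment> \<open>At most 2, 15 and 1 keys of two words each, plus three terminators, make
    39.\<close>
  show "length (encode_level (level_run d \<gamma> ks)) \<le> 39"
    using W Q_length R_length by (simp add: run encode_level_def length_encode_keys)
  show "set (encode_level (level_run d \<gamma> ks))
      \<subseteq> {Counter 0} \<union> (\<Union>k\<in>set ks. {Point (fst k), Time (snd k)})"
    using set_encode_keys[OF W(2)] set_encode_keys[OF Q_subset] set_encode_keys[OF R_subset]
    by (simp only: run encode_level_def prod.case set_append Un_subset_iff)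
qed

definition key_of :: "item \<Rightarrow> key" where
  "key_of x = (pnt x, exp_time x)"

text \<open>The guesses belong to the program and not to the memory. \<open>inv encode\<close>
  recovers the levels by \<open>inj_encode\<close>; 0 is the answer when no guess is
  witnessed.\<close>

definition diameter_algorithm :: "nat \<Rightarrow> real list \<Rightarrow> streaming_algorithm" where
  "diameter_algorithm d \<gamma>s =
     \<lparr>init = encode (map (\<lambda>\<gamma>. ([], [], [])) \<gamma>s),
      process = (\<lambda>m x. encode (map2 (\<lambda>\<gamma> s. level_step d \<gamma> s (key_of x)) \<gamma>s (inv encode m))),
      query = (\<lambda>m t. Max (insert 0 {\<gamma>. \<exists>s. (\<gamma>, s) \<in> set (zip \<gamma>s (inv encode m)) \<and>
        ereal t < horizon (fst s)}))\<rparr>"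

lemma memory_diameter_algorithm:
  "memory (diameter_algorithm d \<gamma>s) xs = encode (map (\<lambda>\<gamma>. level_run d \<gamma> (map key_of xs)) \<gamma>s)"
proof (induction xs rule: rev_induct)
  case Nil
  show ?case by (simp add: memory_def diameter_algorithm_def level_run_def)
next
  case (snoc x xs)
  have "memory (diameter_algorithm d \<gamma>s) (xs @ [x]) =
      encode (map2 (\<lambda>\<gamma> s. level_step d \<gamma> s (key_of x)) \<gamma>s
        (map (\<lambda>\<gamma>. level_run d \<gamma> (map key_of xs)) \<gamma>s))"
    using snoc by (simp add: memory_def diameter_algorithm_def inj_encode)
  then show ?case by (simp add: level_run_def map2_map_map[of _ "\<lambda>x. x", simplified])
qed

lemma query_diameter_algorithm:
  "query (diameter_algorithm d \<gamma>s) (memory (diameter_algorithm d \<gamma>s) xs) t =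
     Max (insert 0 {\<gamma> \<in> set \<gamma>s. ereal t < horizon (fst (level_run d \<gamma> (map key_of xs)))})"
proof -
  have "(\<gamma>, s) \<in> set (zip \<gamma>s (map f \<gamma>s)) \<longleftrightarrow> \<gamma> \<in> set \<gamma>s \<and> s = f \<gamma>"
    for \<gamma> s and f :: "real \<Rightarrow> level"
    by (induction \<gamma>s) auto
  then have "{\<gamma>. \<exists>s. (\<gamma>, s) \<in> set (zip \<gamma>s (map f \<gamma>s)) \<and> ereal t < horizon (fst s)} =
      {\<gamma> \<in> set \<gamma>s. ereal t < horizon (fst (f \<gamma>))}" for f :: "real \<Rightarrow> level"
    by simp
  then show ?thesis
    unfolding memory_diameter_algorithm by (simp add: diameter_algorithm_def inj_encode)
qed

lemma stores_words_diameter_algorithm: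
  assumes "\<And>\<gamma>. \<gamma> \<in> set \<gamma>s \<Longrightarrow> 0 \<le> \<gamma>" and "39 * real (length \<gamma>s) \<le> s"
  shows "stores_words 0 (diameter_algorithm d \<gamma>s) xs s"
  unfolding stores_words_def
proof (intro allI impI conjI ballI)
  fix m assume "m \<le> length xs"
  let ?ys = "take m xs"
  have "length (encode (map (\<lambda>\<gamma>. level_run d \<gamma> (map key_of ?ys)) \<gamma>s)) \<le> 39 * length \<gamma>s"
    using assms(1)
  proof (induction \<gamma>s)
    case (Cons \<gamma> \<gamma>s)
    then show ?case using encode_level_run(1)[of \<gamma> d "map key_of ?ys"] by (simp add: encode_def)
  qed (simp add: encode_def)
  then show "real (length (memory (diameter_algorithm d \<gamma>s) ?ys)) \<le> s"
    using assms(2) by (simp add: memory_diameter_algorithm)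
  fix w assume "w \<in> set (memory (diameter_algorithm d \<gamma>s) ?ys)"
  then obtain \<gamma> where "\<gamma> \<in> set \<gamma>s" "w \<in> set (encode_level (level_run d \<gamma> (map key_of ?ys)))"
    by (auto simp: memory_diameter_algorithm encode_def)
  then show "word_ok 0 (length xs) ?ys w"
    using encode_level_run(2)[of \<gamma> d "map key_of ?ys"] assms(1) by (auto simp: key_of_def)
qed

section \<open>Active items and diameters of finite sets\<close>

lemma set_takeWhile_sorted:
  fixes f :: "'a \<Rightarrow> int" and t :: real
  assumes "sorted (map f xs)"
  shows "set (takeWhile (\<lambda>x. of_int (f x) \<le> t) xs) = {x \<in> set xs. of_int (f x) \<le> t}"
  using assms
proof (induction xs)
  case (Cons x xs)
  then have "real_of_int (f x) \<le> of_int (f y)" if "y \<in> set xs" for y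
    using that by auto
  then have "\<not> of_int (f y) \<le> t" if "y \<in> set xs" "\<not> of_int (f x) \<le> t" for y
    using that by (meson order_trans)
  then show ?case using Cons by auto
qed simp

lemma finite_edist_set:
  assumes "finite X"
  shows "finite {edist d x y |x y. x \<in> X \<and> y \<in> X}"
proof -
  have "{edist d x y |x y. x \<in> X \<and> y \<in> X} = (\<lambda>(x, y). edist d x y) ` (X \<times> X)"
    by auto
  then show ?thesis using assms by simp
qed

lemma edist_le_diam:
  assumes "finite X" "x \<in> X" "y \<in> X"
  shows "edist d x y \<le> diam d X"
  using assms unfolding diam_def by (auto intro!: Max_ge finite_edist_set)

lemma diam_le:
  assumes "finite X" "0 \<le> B" "\<And>x y. x \<in> X \<Longrightarrow> y \<in> X \<Longrightarrow> edist d x y \<le> B"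
  shows "diam d X \<le> B"
proof (cases "X = {}")
  case False
  then have "{edist d x y |x y. x \<in> X \<and> y \<in> X} \<noteq> {}" by blast
  then show ?thesis
    using False assms unfolding diam_def by (subst if_not_P) (auto simp: finite_edist_set)
qed (use assms in \<open>simp add: diam_def\<close>)

lemma diam_nonneg:
  assumes "finite X"
  shows "0 \<le> diam d X"
proof (cases "X = {}")
  case False
  then obtain x where "x \<in> X" by blast
  then show ?thesis using edist_le_diam[OF assms, of x x d] by simp
qed (simp add: diam_def)

text \<open>
  The grid starts at \<open>1/3\<close> because \<open>(1 + \<surd>3) / 3 < 1\<close>: without a witness for the lowest guess, all
  active points coincide.
\<close>

definition guesses :: "real \<Rightarrow> nat \<Rightarrow> real list" where
  "guesses \<delta> n = map (\<lambda>i. (1 + \<delta>) ^ i / 3) [0..<n]"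

text \<open>The pair behind the largest witnessed guess bounds the diameter from below. The next
  guess is unwitnessed and bounds it from above, and one grid step costs a factor
  \<open>1 + \<delta>\<close>.\<close>

lemma answer_diameter_algorithm:
  assumes xs: "valid_stream d \<Delta> xs"
    and \<delta>: "0 < \<delta>" and n: "3 * \<Delta> < (1 + \<delta>) ^ n"
    and \<epsilon>: "(1 + sqrt 3) * \<delta> \<le> \<epsilon>"
  defines "A \<equiv> diameter_algorithm d (guesses \<delta> (Suc n))"
  shows "answer A xs t \<le> diam d (pnt ` active xs t)"
    and "diam d (pnt ` active xs t) \<le> (1 + sqrt 3 + \<epsilon>) * answer A xs t"
proof -
  define ks where "ks = map key_of (takeWhile (\<lambda>x. of_int (ins_time x) \<le> t) xs)"
  define g where "g i = (1 + \<delta>) ^ i / 3" for i :: nat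
  define wit where "wit \<gamma> \<longleftrightarrow> ereal t < horizon (fst (level_run d \<gamma> ks))" for \<gamma>
  let ?X = "pnt ` active xs t"
  let ?alive = "{k \<in> set ks. ereal t < snd k}"
  have pos: "0 < g i" for i using \<delta> by (simp add: g_def)
  have ans: "answer A xs t = Max (insert 0 {\<gamma> \<in> g ` {..n}. wit \<gamma>})"
    unfolding answer_def A_def query_diameter_algorithm
    by (simp add: guesses_def g_def[abs_def] wit_def ks_def atLeast0LessThan lessThan_Suc_atMost
        del: upt_Suc)
  have X: "?X = fst ` ?alive"
    using xs set_takeWhile_sorted[of ins_time xs t]
    by (force simp: valid_stream_def active_def ks_def key_of_def image_iff)
  have fin: "finite ?X" by (simp add: X)
  have upper: "edist d p q \<le> \<Delta>" and lower: "1 \<le> edist d p q" if "p \<in> ?X" "q \<in> ?X" "p \<noteq> q" for p q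
    using xs that by (auto simp: valid_stream_def active_def)
  have wit_le: "\<exists>p\<in>?X. \<exists>q\<in>?X. g i \<le> edist d p q" if wit: "wit (g i)" for i
  proof -
    obtain a b where "a \<in> ?alive" "b \<in> ?alive" "g i \<le> kdist d a b"
    proof (rule witnessed)
      show "0 \<le> g i" using pos[of i] by simp
      show "ereal t < horizon (fst (level_run d (g i) ks))" using wit by (simp add: wit_def)
    qed simp
    then show ?thesis unfolding X by blast
  qed
  have not_wit: "diam d ?X \<le> (1 + sqrt 3) * g i" if "\<not> wit (g i)" for i
  proof (rule diam_le[OF fin])
    show "0 \<le> (1 + sqrt 3) * g i" using pos[of i] by simp
    fix p q assume "p \<in> ?X" "q \<in> ?X"
    then obtain a b where "a \<in> ?alive" "b \<in> ?alive" "p = fst a" "q = fst b"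
      unfolding X by blast
    then show "edist d p q \<le> (1 + sqrt 3) * g i"
      using that unwitnessed[of "g i" "ereal t" d ks a b] pos[of i] by (simp add: wit_def)
  qed
  \<comment> \<open>A witnessed guess is at most \<open>\<Delta>\<close>, while \<open>g n\<close>
    exceeds it; so every witnessed index lies on the finite grid.\<close>
  have wit_less: "i < n" if w: "wit (g i)" for i
  proof -
    obtain p q where pq: "p \<in> ?X" "q \<in> ?X" "g i \<le> edist d p q" using wit_le[OF w] by blast
    then have "p \<noteq> q" using pos[of i] by auto
    then have "g i \<le> \<Delta>" using upper[OF pq(1,2)] pq(3) by simp
    then have "(1 + \<delta>) ^ i < (1 + \<delta>) ^ n" using n by (simp add: g_def)
    then show ?thesis using \<delta> by (simp add: power_strict_increasing_iff)
  qed
  have diam0: "0 \<le> diam d ?X" by (rule diam_nonneg[OF fin])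
  show "answer A xs t \<le> diam d ?X"
  proof -
    have "g i \<le> diam d ?X" if "wit (g i)" for i
      using wit_le[OF that] edist_le_diam[OF fin] order_trans by blast
    then show ?thesis unfolding ans using diam0 by (subst Max_le_iff) auto
  qed
  have ans_ge: "0 \<le> answer A xs t" "wit (g i) \<Longrightarrow> g i \<le> answer A xs t" for i
    unfolding ans using wit_less[of i] by (auto intro!: Max_ge)
  have factor: "0 \<le> 1 + sqrt 3 + \<epsilon>"
    using \<epsilon> \<delta> by (smt (verit) mult_nonneg_nonneg real_sqrt_ge_zero)
  show "diam d ?X \<le> (1 + sqrt 3 + \<epsilon>) * answer A xs t"
  proof (cases "\<exists>i. wit (g i)")
    case False
    then have "\<not> wit (g 0)" by blast
    then have "diam d ?X \<le> (1 + sqrt 3) / 3" using not_wit[of 0] by (simp add: g_def)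
    also have "\<dots> < 1" using sqrt3_less by simp
    finally have "diam d ?X < 1" .
    then have "edist d p q = 0" if "p \<in> ?X" "q \<in> ?X" for p q
      using lower[OF that] edist_le_diam[OF fin that, of d] by (cases "p = q") auto
    then have "diam d ?X \<le> 0" by (intro diam_le[OF fin]) auto
    also have "\<dots> \<le> (1 + sqrt 3 + \<epsilon>) * answer A xs t"
      using factor ans_ge by simp
    finally show ?thesis .
  next
    case True
    define i where "i = Max {i. wit (g i)}"
    have fin_i: "finite {i. wit (g i)}"
      by (rule finite_subset[of _ "{..<n}"]) (use wit_less in auto)
    then have i: "wit (g i)" using True Max_in[of "{i. wit (g i)}"] by (auto simp: i_def)
    have "\<not> wit (g (Suc i))" using Max_ge[OF fin_i, of "Suc i"] by (auto simp: i_def)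
    then have "diam d ?X \<le> (1 + sqrt 3) * g (Suc i)" by (rule not_wit)
    also have "\<dots> = (1 + sqrt 3 + (1 + sqrt 3) * \<delta>) * g i"
      by (simp add: g_def algebra_simps add_divide_distrib)
    also have "\<dots> \<le> (1 + sqrt 3 + \<epsilon>) * g i"
      using \<epsilon> pos[of i] by (intro mult_right_mono) auto
    also have "\<dots> \<le> (1 + sqrt 3 + \<epsilon>) * answer A xs t"
      using ans_ge(2)[OF i] factor by (rule mult_left_mono)
    finally show ?thesis .
  qed
qed

section \<open>Size of the grid and the final constants\<close>

text \<open>The bound rests on \<open>\<delta> / 2 \<le> ln (1 + \<delta>)\<close> for
  \<open>\<delta> \<le> 1\<close>; adding 1 to the floor makes the inequality strict, also for
  \<open>y = 1\<close>.\<close>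

lemma ex_power_gt:
  assumes \<delta>: "0 < \<delta>" "\<delta> \<le> 1" and y: "1 \<le> y"
  obtains n where "y < (1 + \<delta>) ^ n" "real n \<le> 2 * ln y / \<delta> + 1"
proof
  let ?n = "nat \<lfloor>2 * ln y / \<delta>\<rfloor> + 1"
  have nonneg: "0 \<le> 2 * ln y / \<delta>" using \<delta> y by simp
  then show "real ?n \<le> 2 * ln y / \<delta> + 1" by linarith
  have "2 * ln y / \<delta> < real ?n" using nonneg by linarith
  then have "ln y < real ?n * (\<delta> / 2)" using \<delta> by (simp add: field_simps)
  also have "\<delta> / 2 \<le> ln (1 + \<delta>)"
  proof -
    have "exp (\<delta> / 2) \<le> 1 + \<delta> / 2 + (\<delta> / 2)\<^sup>2"
      using \<delta> by (intro exp_bound) auto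
    also have "(\<delta> / 2)\<^sup>2 \<le> \<delta> / 2"
      using \<delta> by (simp add: power2_eq_square mult_left_le field_simps)
    also have "1 + \<delta> / 2 + \<delta> / 2 = 1 + \<delta>" by simp
    finally show ?thesis using \<delta> by (subst ln_ge_iff) auto
  qed
  also have "real ?n * ln (1 + \<delta>) = ln ((1 + \<delta>) ^ ?n)"
    by (rule ln_realpow[symmetric])
  finally have "ln y < ln ((1 + \<delta>) ^ ?n)" by simp
  then show "y < (1 + \<delta>) ^ ?n"
    using \<delta> y by (subst (asm) ln_less_cancel_iff) auto
qed

theorem theorem1p2:
  "\<exists>(C::real) (b::nat poly). \<forall>(d::nat) (\<epsilon>::real) (\<Delta>::real). \<epsilon> > 0 \<and> \<Delta> \<ge> 1 \<longrightarrow>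
     (\<exists>A::streaming_algorithm. \<forall>xs. valid_stream d \<Delta> xs \<longrightarrow>
        stores_words b A xs (C * space_bound \<epsilon> \<Delta>) \<and>
        (\<forall>t::real.
           answer A xs t \<le> diam d (pnt ` active xs t) \<and>
           diam d (pnt ` active xs t) \<le> (1 + sqrt 3 + \<epsilon>) * answer A xs t))"
proof (rule exI[of _ 780], rule exI[of _ 0], intro allI impI)
  fix d :: nat and \<epsilon> \<Delta> :: real
  assume "\<epsilon> > 0 \<and> \<Delta> \<ge> 1"
  then have \<epsilon>: "0 < \<epsilon>" and \<Delta>: "1 \<le> \<Delta>" by auto
  define M where "M = max 1 (1 / \<epsilon>)"
  define L where "L = max 1 (ln \<Delta>)"
  \<comment> \<open>The factor 3 exceeds \<open>1 + sqrt 3\<close>, so the loss per grid step stays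
    below \<open>\<epsilon>\<close>; \<open>M \<ge> 1\<close> keeps
    \<open>\<delta> \<le> 1\<close>.\<close>
  define \<delta> where "\<delta> = 1 / (3 * M)"
  have M: "1 \<le> M" "1 / M \<le> \<epsilon>" and L: "1 \<le> L" "ln \<Delta> \<le> L"
    using \<epsilon> by (auto simp: M_def L_def field_simps max_def)
  have \<delta>: "0 < \<delta>" "\<delta> \<le> 1" "\<delta> \<le> \<epsilon> / 3"
    using M by (auto simp: \<delta>_def field_simps)
  obtain n where n: "3 * \<Delta> < (1 + \<delta>) ^ n" "real n \<le> 2 * ln (3 * \<Delta>) / \<delta> + 1"
    using ex_power_gt[of \<delta> "3 * \<Delta>"] \<delta> \<Delta> by auto
  have "ln (3 * \<Delta>) = ln 3 + ln \<Delta>" using \<Delta> by (simp add: ln_mult)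
  also have "\<dots> \<le> 2 + L" using ln_le_minus_one[of 3] L by simp
  also have "\<dots> \<le> 3 * L" using L by simp
  finally have "2 * ln (3 * \<Delta>) / \<delta> \<le> 2 * (3 * L) / \<delta>"
    using \<delta> by (intro divide_right_mono) auto
  also have "\<dots> = 18 * (M * L)" by (simp add: \<delta>_def)
  finally have "real n + 1 \<le> 18 * (M * L) + 2" using n(2) by simp
  moreover have "1 \<le> M * L" using mult_mono[of 1 M 1 L] M L by simp
  \<comment> \<open>There are \<open>n + 1 \<le> 20 * (M * L)\<close> guesses of 39 words each, and
    \<open>780 = 39 * 20\<close>.\<close>
  ultimately have space: "39 * real (length (guesses \<delta> (Suc n))) \<le> 780 * space_bound \<epsilon> \<Delta>"
    by (simp add: guesses_def space_bound_def M_def L_def)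
  have "(1 + sqrt 3) * \<delta> \<le> 3 * (\<epsilon> / 3)"
    using sqrt3_less \<delta> by (intro mult_mono) auto
  then have ratio: "(1 + sqrt 3) * \<delta> \<le> \<epsilon>" by simp
  let ?A = "diameter_algorithm d (guesses \<delta> (Suc n))"
  have "stores_words 0 ?A xs (780 * space_bound \<epsilon> \<Delta>)" for xs
    using \<delta> space by (intro stores_words_diameter_algorithm) (auto simp: guesses_def simp del: upt_Suc)
  then show "\<exists>A::streaming_algorithm. \<forall>xs. valid_stream d \<Delta> xs \<longrightarrow>
        stores_words 0 A xs (780 * space_bound \<epsilon> \<Delta>) \<and>
        (\<forall>t::real.
           answer A xs t \<le> diam d (pnt ` active xs t) \<and>
           diam d (pnt ` active xs t) \<le> (1 + sqrt 3 + \<epsilon>) * answer A xs t)"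
    using answer_diameter_algorithm[OF _ \<delta>(1) n(1) ratio] by blast
qed

end
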